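(* Let $n\ge4$ be an integer. The inertia of the distance matrix $D(H_n)$ of the helm graph $H_n$ is $$\mathrm{In}(D(H_n))=\begin{cases}(1,\,2n-2,\,0)&\text{if $n$ is even},\\ (1,\,2n-3,\,1)&\text{if $n$ is odd}.\end{cases}$$
   Context: The inertia $\mathrm{In}(M)$ of a real symmetric matrix $M$ is the ordered triple $(i_+,i_-,i_0)$ of the numbers of positive, negative and zero eigenvalues of $M$, counted with multiplicity. Helm graph: for $n\ge4$, the wheel $W_n$ consists of a cycle on $v_1,\dots,v_{n-1}$ together with a vertex $v_0$ adjacent to all $v_i$; the helm graph $H_n$ (on $2n-1$ vertices) is obtained from $W_n$ by attaching to each $v_i$, $1\le i\le n-1$, a pendant vertex $u_i$. The distance matrix $D(H_n)$ has as entries the shortest-path distances, with vertices ordered $v_0,v_1,\dots,v_{n-1},u_1,\dots,u_{n-1}$. Explicitly, $$D(H_n)=\begin{bmatrix}0&\mathbf{e}'&2\mathbf{e}'\\ \mathbf{e}&2J_{n-1}-S&3J_{n-1}-S\\ 2\mathbf{e}&3J_{n-1}-S&4J_{n-1}-S-2I_{n-1}\end{bmatrix},$$ where a prime denotes transpose, $\mathbf{e}\in\mathbb{R}^{n-1}$ is the all-ones vector, $J_{n-1}$ the all-ones matrix, $I_{n-1}$ the identity, and $S$ is the circulant matrix of order $n-1$ with first row $(2,1,0,\dots,0,1)$ (each row is the previous one cyclically shifted one place to the right). *)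

theory Defs
  imports Jordan_Normal_Form.Char_Poly Graph_Theory.Graph_Theory
begin

text \<open>Eigenvalues are counted with algebraic multiplicity. Only real eigenvalues occur, so the
  notion is the usual one for symmetric matrices, whose spectrum is real.\<close>

definition inertia :: "real mat \<Rightarrow> nat \<times> nat \<times> nat" where
  "inertia M =
    ((\<Sum>k | eigenvalue M k \<and> k > 0. order k (char_poly M)),
     (\<Sum>k | eigenvalue M k \<and> k < 0. order k (char_poly M)),
     (\<Sum>k | eigenvalue M k \<and> k = 0. order k (char_poly M)))"

text \<open>Undirected graphs are symmetric digraphs without loops or parallel arcs (\<open>pair_graph\<close>).
  Shortest-path distances are those of \<open>Graph_Theory\<close> for unit arc costs; they are extended
  reals, and finite whenever the graph is connected.\<close>

definition graph_dist :: "'a pair_pre_digraph \<Rightarrow> 'a \<Rightarrow> 'a \<Rightarrow> real" where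
  "graph_dist G u v = real_of_ereal (wf_digraph.\<mu> (with_proj G) (\<lambda>_. 1) u v)"

definition distance_matrix :: "'a pair_pre_digraph \<Rightarrow> 'a list \<Rightarrow> real mat" where
  "distance_matrix G vs =
    mat (length vs) (length vs) (\<lambda>(i, j). graph_dist G (vs ! i) (vs ! j))"

text \<open>\<open>Wheel i\<close> is the vertex $v_i$ (so \<open>Wheel 0\<close> is the hub) and \<open>Pendant i\<close> the vertex $u_i$.\<close>

datatype helm_vertex = Wheel nat | Pendant nat

definition wheel_edges :: "nat \<Rightarrow> (helm_vertex \<times> helm_vertex) set" where
  "wheel_edges n =
    {(Wheel i, Wheel (i + 1)) | i. 1 \<le> i \<and> i < n - 1} \<union> {(Wheel (n - 1), Wheel 1)} \<union>
    {(Wheel 0, Wheel i) | i. 1 \<le> i \<and> i \<le> n - 1}"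

definition helm_edges :: "nat \<Rightarrow> (helm_vertex \<times> helm_vertex) set" where
  "helm_edges n = wheel_edges n \<union> {(Wheel i, Pendant i) | i. 1 \<le> i \<and> i \<le> n - 1}"

definition helm_vertices :: "nat \<Rightarrow> helm_vertex list" where
  "helm_vertices n = map Wheel [0..<n] @ map Pendant [1..<n]"

definition helm_graph :: "nat \<Rightarrow> helm_vertex pair_pre_digraph" where
  "helm_graph n =
    \<lparr> pverts = set (helm_vertices n), parcs = helm_edges n \<union> (helm_edges n)\<inverse> \<rparr>"

lemma length_helm_vertices: "n \<ge> 1 \<Longrightarrow> length (helm_vertices n) = 2 * n - 1"
  by (simp add: helm_vertices_def)

lemma distinct_helm_vertices: "distinct (helm_vertices n)"
  by (auto simp: helm_vertices_def distinct_map inj_on_def)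

lemma pair_graph_helm_graph:
  assumes "n \<ge> 4"
  shows "pair_graph (helm_graph n)"
proof -
  have sub: "helm_edges n \<subseteq> set (helm_vertices n) \<times> set (helm_vertices n)"
    using assms by (auto simp: helm_edges_def wheel_edges_def helm_vertices_def)
  have noloop: "(x, x) \<notin> helm_edges n" for x
    using assms by (auto simp: helm_edges_def wheel_edges_def)
  have fin: "finite (helm_edges n)"
    by (rule finite_subset[OF sub]) simp
  show ?thesis
  proof
    show "finite (pverts (helm_graph n))" "finite (parcs (helm_graph n))"
      using fin by (simp_all add: helm_graph_def)
    show "fst e \<in> pverts (helm_graph n)" "snd e \<in> pverts (helm_graph n)"
      if "e \<in> parcs (helm_graph n)" for e
      using that sub by (auto simp: helm_graph_def)
    show "fst e \<noteq> snd e" if "e \<in> parcs (helm_graph n)" for e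
      using that noloop by (cases e) (auto simp: helm_graph_def)
    show "symmetric (with_proj (helm_graph n))"
      by (auto simp: symmetric_def arcs_ends_conv helm_graph_def sym_def image_iff)
  qed
qed

end

theory Submission
  imports Defs Jordan_Normal_Form.Schur_Decomposition Jordan_Normal_Form.Spectral_Radius
begin

text \<open>
  Write a vector as $x = (a, p, q)$ with $p, q \in \mathbb{R}^{n-1}$, let $P$ and $Q$ be the
  coordinate sums of $p$ and $q$, and put $r = p + q$. Since the circulant matrix $S$ has the
  quadratic form $\sum_i (r_i + r_{i+1})^2$ (indices cyclic),
  $$x' D x = 2 (P + 2 Q) (a + P + Q) - \sum_i (r_i + r_{i+1})^2 - 2 \sum_i q_i^2 .$$
  The form is negative semidefinite on the hyperplane $P + 2 Q = 0$, so there is at most one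
  positive eigenvalue, and exactly one because the form takes a positive value. The hub coordinate
  of $D x$ is $P + 2 Q$, so on the kernel the two sums of squares vanish; this leaves $a = 0$,
  $q = 0$ and $p_{i+1} = - p_i$ around the cycle, which has a nonzero solution iff $n - 1$ is even.
\<close>

section \<open>Orthogonal diagonalisation of real symmetric matrices\<close>

lemma scalar_prod_self_nonneg: "(w :: real vec) \<bullet> w \<ge> 0"
  by (simp add: scalar_prod_def sum_nonneg)

lemma scalar_prod_self_pos: "w \<in> carrier_vec n \<Longrightarrow> w \<noteq> 0\<^sub>v n \<Longrightarrow> (w :: real vec) \<bullet> w > 0"
  using conjugate_square_greater_0_vec[of w n] by simp

text \<open>Complete \<open>v\<close> to a basis and run Gram-Schmidt with \<open>v\<close> first,
  so that \<open>v\<close> itself survives as the first orthogonal vector; then normalise. Only the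
  direction of the first column is prescribed, which is what deflation needs.\<close>

lemma orthonormal_basis_extension:
  fixes v :: "real vec"
  assumes v: "v \<in> carrier_vec n" "v \<noteq> 0\<^sub>v n"
  obtains U c where "U \<in> carrier_mat n n" "U\<^sup>T * U = 1\<^sub>m n" "col U 0 = c \<cdot>\<^sub>v v"
proof -
  interpret cof_vec_space n "TYPE(real)" .
  define b where "b = basis_completion v"
  define ws where "ws = gram_schmidt n b"
  note b = basis_completion[OF v, folded b_def]
  have n: "n \<noteq> 0" using v by (metis carrier_vecD eq_vecI less_nat_zero_code zero_carrier_vec)
  obtain vs where bv: "b = v # vs" using b(6,7) n by (cases b) auto
  have ws: "set ws \<subseteq> carrier_vec n" "corthogonal ws" "length ws = n"
    using gram_schmidt_result[OF b(2,4,5) ws_def] b(6) by auto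
  have "hd ws = v" using gram_schmidt_hd[OF v(1)] by (simp only: ws_def bv)
  then have ws0: "ws ! 0 = v"
    using ws(3) n by (metis hd_conv_nth list.size(3))
  have wsc: "ws ! i \<in> carrier_vec n" if "i < n" for i
    using ws that by (metis nth_mem subsetD)
  have orth: "ws ! i \<bullet> ws ! j = 0 \<longleftrightarrow> i \<noteq> j" if "i < n" "j < n" for i j
    using corthogonalD[OF ws(2), of i j] ws(3) that by simp
  define c where "c i = 1 / sqrt (ws ! i \<bullet> ws ! i)" for i
  define U where "U = mat_of_cols n (map (\<lambda>i. c i \<cdot>\<^sub>v ws ! i) [0..<n])"
  have U: "U \<in> carrier_mat n n" by (auto simp: U_def)
  have colU: "col U i = c i \<cdot>\<^sub>v ws ! i" if "i < n" for i
    using that wsc by (simp add: U_def col_mat_of_cols)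
  \<comment> \<open>The case i = j of \<open>orth\<close> says that the square norm is
    nonzero.\<close>
  have pos: "ws ! i \<bullet> ws ! i > 0" if "i < n" for i
    using orth[OF that that] scalar_prod_self_nonneg[of "ws ! i"] by linarith
  have cc: "c i * (c i * (ws ! i \<bullet> ws ! i)) = 1" if "i < n" for i
    using pos[OF that] by (simp add: c_def field_simps)
  have "(c i \<cdot>\<^sub>v ws ! i) \<bullet> (c j \<cdot>\<^sub>v ws ! j) = c i * (c j * (ws ! i \<bullet> ws ! j))" if "i < n" "j < n" for i j
    using wsc[OF that(1)] wsc[OF that(2)]
    by (simp add: smult_scalar_prod_distrib[of _ n] scalar_prod_smult_distrib[of _ n])
  then have "U\<^sup>T * U = 1\<^sub>m n"
    by (intro eq_matI) (use U in \<open>auto simp: colU orth cc\<close>)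
  then show ?thesis using that[OF U] colU[of 0] ws0 n by auto
qed

text \<open>Over the complex numbers an eigenvector z = x + iy exists. Symmetry forces its
  eigenvalue to be real, and then x and y are each mapped to that multiple of themselves, while at
  least one of them is nonzero.\<close>

lemma symmetric_real_eigenvector:
  fixes A :: "real mat"
  assumes A: "A \<in> carrier_mat n n" and sym: "A\<^sup>T = A" and n: "n > 0"
  obtains k v where "v \<in> carrier_vec n" "v \<noteq> 0\<^sub>v n" "A *\<^sub>v v = k \<cdot>\<^sub>v v"
proof -
  define B where "B = map_mat complex_of_real A"
  have B: "B \<in> carrier_mat n n" using A by (simp add: B_def)
  obtain c z where z: "z \<in> carrier_vec n" "z \<noteq> 0\<^sub>v n" and ev: "B *\<^sub>v z = c \<cdot>\<^sub>v z"
    using spectrum_non_empty[OF B n] B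
    by (auto simp: spectrum_def eigenvalue_def eigenvector_def)
  define x where "x = map_vec Re z"
  define y where "y = map_vec Im z"
  have x: "x \<in> carrier_vec n" and y: "y \<in> carrier_vec n" using z by (auto simp: x_def y_def)
  have row: "(\<Sum>j<n. of_real (A $$ (i,j)) * z $ j) = c * z $ i" if "i < n" for i
  proof -
    have "(B *\<^sub>v z) $ i = (\<Sum>j<n. of_real (A $$ (i,j)) * z $ j)"
      using that A z by (auto simp: B_def scalar_prod_def atLeast0LessThan intro!: sum.cong)
    then show ?thesis using that z ev by simp
  qed
  have mv: "(A *\<^sub>v w) $ i = (\<Sum>j<n. A $$ (i,j) * w $ j)" if "i < n" "w \<in> carrier_vec n" for i w
    using that A by (auto simp: scalar_prod_def atLeast0LessThan intro!: sum.cong)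
  have Ax: "A *\<^sub>v x = Re c \<cdot>\<^sub>v x - Im c \<cdot>\<^sub>v y"
  proof (rule eq_vecI)
    show "dim_vec (A *\<^sub>v x) = dim_vec (Re c \<cdot>\<^sub>v x - Im c \<cdot>\<^sub>v y)" using A x y by simp
    fix i assume "i < dim_vec (Re c \<cdot>\<^sub>v x - Im c \<cdot>\<^sub>v y)"
    then have i: "i < n" using y by simp
    show "(A *\<^sub>v x) $ i = (Re c \<cdot>\<^sub>v x - Im c \<cdot>\<^sub>v y) $ i"
      using arg_cong[OF row[OF i], of Re] i z by (simp add: mv x) (simp add: x_def y_def)
  qed
  have Ay: "A *\<^sub>v y = Im c \<cdot>\<^sub>v x + Re c \<cdot>\<^sub>v y"
  proof (rule eq_vecI)
    show "dim_vec (A *\<^sub>v y) = dim_vec (Im c \<cdot>\<^sub>v x + Re c \<cdot>\<^sub>v y)" using A x y by simp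
    fix i assume "i < dim_vec (Im c \<cdot>\<^sub>v x + Re c \<cdot>\<^sub>v y)"
    then have i: "i < n" using y by simp
    show "(A *\<^sub>v y) $ i = (Im c \<cdot>\<^sub>v x + Re c \<cdot>\<^sub>v y) $ i"
      using arg_cong[OF row[OF i], of Im] i z by (simp add: mv y) (simp add: x_def y_def algebra_simps)
  qed
  \<comment> \<open>Expanding both sides with \<open>Ax\<close> and \<open>Ay\<close>, the terms in
    Re c cancel and Im c times the square norm of z remains.\<close>
  have "y \<bullet> (A *\<^sub>v x) = (A *\<^sub>v y) \<bullet> x"
    using transpose_vec_mult_scalar[OF A x y] sym by simp
  then have "Im c * (x \<bullet> x + y \<bullet> y) = 0"
    using x y comm_scalar_prod[OF x y]
    by (simp add: Ax Ay scalar_prod_minus_distrib[of _ n] add_scalar_prod_distrib[of _ n] algebra_simps)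
  moreover have ne: "x \<noteq> 0\<^sub>v n \<or> y \<noteq> 0\<^sub>v n"
  proof (rule ccontr)
    assume "\<not> ?thesis"
    then have 0: "x = 0\<^sub>v n" "y = 0\<^sub>v n" by auto
    have "z = 0\<^sub>v n"
    proof (rule eq_vecI)
      fix i assume "i < dim_vec (0\<^sub>v n :: complex vec)"
      then have i: "i < n" by simp
      have "Re (z $ i) = 0" "Im (z $ i) = 0"
        using arg_cong[OF 0(1), of "\<lambda>w. w $ i"] arg_cong[OF 0(2), of "\<lambda>w. w $ i"] i z
        by (auto simp: x_def y_def)
      then show "z $ i = 0\<^sub>v n $ i" using i by (simp add: complex_eq_iff)
    qed (use z in auto)
    then show False using z by simp
  qed
  have "x \<bullet> x + y \<bullet> y > 0"
    using ne scalar_prod_self_pos[OF x] scalar_prod_self_pos[OF y] scalar_prod_self_nonneg[of x] scalar_prod_self_nonneg[of y] by linarith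
  ultimately have "Im c = 0" by simp
  then have "A *\<^sub>v x = Re c \<cdot>\<^sub>v x" "A *\<^sub>v y = Re c \<cdot>\<^sub>v y"
    using Ax Ay x y by auto
  then show ?thesis using ne that x y by blast
qed

text \<open>Deflation: conjugating by an orthogonal matrix whose first column is an eigenvector
  clears the first column off the diagonal, symmetry then clears the first row, and the induction
  hypothesis diagonalises the remaining block.\<close>

theorem real_spectral_theorem:
  fixes A :: "real mat"
  assumes "A \<in> carrier_mat n n" "A\<^sup>T = A"
  shows "\<exists>P d. P \<in> carrier_mat n n \<and> P\<^sup>T * P = 1\<^sub>m n \<and> P\<^sup>T * A * P = mat_diag n d"
  using assms
proof (induction n arbitrary: A)
  case 0
  show ?case
    by (intro exI[of _ "0\<^sub>m 0 0"] exI[of _ "\<lambda>_. 0"] conjI eq_matI) (auto simp: mat_diag_def)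
next
  case (Suc n)
  note A = Suc.prems(1)
  obtain k v where v: "v \<in> carrier_vec (Suc n)" "v \<noteq> 0\<^sub>v (Suc n)" "A *\<^sub>v v = k \<cdot>\<^sub>v v"
    using symmetric_real_eigenvector[OF Suc.prems] by blast
  obtain U c where U: "U \<in> carrier_mat (Suc n) (Suc n)" "U\<^sup>T * U = 1\<^sub>m (Suc n)" 
    and c: "col U 0 = c \<cdot>\<^sub>v v"
    using orthonormal_basis_extension[OF v(1,2)] by blast
  have ev: "A *\<^sub>v col U 0 = k \<cdot>\<^sub>v col U 0"
    using A v by (simp add: c mult_mat_vec[OF A v(1)] smult_smult_assoc mult.commute)
  define B where "B = U\<^sup>T * A * U"
  have B: "B \<in> carrier_mat (Suc n) (Suc n)" using U A by (auto simp: B_def)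
  have Bsym: "B\<^sup>T = B"
    using U A Suc.prems(2) 
    by (simp add: B_def transpose_mult[of _ "Suc n" "Suc n" _ "Suc n"] assoc_mult_mat[of _ "Suc n" "Suc n" _ "Suc n" _ "Suc n"])
  have B0: "B $$ (i, 0) = (if i = 0 then k else 0)" if "i < Suc n" for i
  proof -
    have "B $$ (i, 0) = (U\<^sup>T * (A * U)) $$ (i, 0)"
      using U A by (simp add: B_def assoc_mult_mat[of _ "Suc n" "Suc n" _ "Suc n" _ "Suc n"])
    also have "\<dots> = col U i \<bullet> (A *\<^sub>v col U 0)"
      using U A that col_mult2[OF A U(1), of 0] by (subst index_mult_mat(1)) simp_all
    also have "\<dots> = k * (U\<^sup>T * U) $$ (i, 0)"
      using U(1) that by (simp add: ev)
    finally show ?thesis using that U(2) by simp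
  qed
  define B' where "B' = mat n n (\<lambda>(i,j). B $$ (Suc i, Suc j))"
  have B': "B' \<in> carrier_mat n n" by (simp add: B'_def)
  have Bs: "B $$ (i, j) = B $$ (j, i)" if "i < Suc n" "j < Suc n" for i j
    using arg_cong[OF Bsym, of "\<lambda>M. M $$ (i,j)"] that B by simp
  have B's: "B'\<^sup>T = B'"
    by (rule eq_matI) (auto simp: B'_def Bs)
  obtain P' d' where P': "P' \<in> carrier_mat n n" "P'\<^sup>T * P' = 1\<^sub>m n" "P'\<^sup>T * B' * P' = mat_diag n d'"
    using Suc.IH[OF B' B's] by blast
  \<comment> \<open>The direct sum of 1 and \<open>P'\<close> leaves the split-off eigenvalue alone,
    so \<open>U * Q\<close> diagonalises \<open>A\<close>.\<close>
  define Q where "Q = four_block_mat (1\<^sub>m 1) (0\<^sub>m 1 n) (0\<^sub>m n 1) P'"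
  have Q: "Q \<in> carrier_mat (Suc n) (Suc n)" using P' by (auto simp: Q_def)
  have Bb: "B = four_block_mat (mat 1 1 (\<lambda>_. k)) (0\<^sub>m 1 n) (0\<^sub>m n 1) B'"
    by (rule eq_matI) (use B B0 Bs in \<open>auto simp: B'_def\<close>)
  have QT: "Q\<^sup>T = four_block_mat (1\<^sub>m 1) (0\<^sub>m 1 n) (0\<^sub>m n 1) P'\<^sup>T"
    using P' by (simp add: Q_def transpose_four_block_mat[of _ 1 1 _ n _ n])
  have QTQ: "Q\<^sup>T * Q = 1\<^sub>m (Suc n)"
    unfolding QT unfolding Q_def using P'
    by (subst mult_four_block_mat[of _ 1 1 _ n _ n _ _ 1 _ n]) auto
  have "Q\<^sup>T * B = four_block_mat (mat 1 1 (\<lambda>_. k)) (0\<^sub>m 1 n) (0\<^sub>m n 1) (P'\<^sup>T * B')"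
    unfolding QT Bb using P' B'
    by (subst mult_four_block_mat[of _ 1 1 _ n _ n _ _ 1 _ n]) auto
  then have "Q\<^sup>T * B * Q = four_block_mat (mat 1 1 (\<lambda>_. k)) (0\<^sub>m 1 n) (0\<^sub>m n 1) (P'\<^sup>T * B' * P')"
    unfolding Q_def using P' B'
    by (simp, subst mult_four_block_mat[of _ 1 1 _ n _ n _ _ 1 _ n]) auto
  also have "\<dots> = mat_diag (Suc n) (\<lambda>i. if i = 0 then k else d' (i - 1))"
    unfolding P'(3) by (rule eq_matI) (auto simp: mat_diag_def)
  finally have diag: "Q\<^sup>T * B * Q = mat_diag (Suc n) (\<lambda>i. if i = 0 then k else d' (i - 1))" .
  note assoc = assoc_mult_mat[of _ "Suc n" "Suc n" _ "Suc n" _ "Suc n"]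
  have "(U * Q)\<^sup>T * (U * Q) = Q\<^sup>T * ((U\<^sup>T * U) * Q)"
    using U(1) Q by (simp add: transpose_mult[of _ "Suc n" "Suc n" _ "Suc n"] assoc)
  then have 1: "(U * Q)\<^sup>T * (U * Q) = 1\<^sub>m (Suc n)" using U(2) Q QTQ by simp
  have "(U * Q)\<^sup>T * A * (U * Q) = Q\<^sup>T * B * Q"
    using U(1) Q A by (simp add: B_def transpose_mult[of _ "Suc n" "Suc n" _ "Suc n"] assoc)
  then show ?case using 1 diag U Q by (metis mult_carrier_mat)
qed

section \<open>Inertia\<close>

lemma order_char_poly_mat_diag:
  fixes d :: "nat \<Rightarrow> real"
  shows "order k (char_poly (mat_diag n d)) = card {i. i < n \<and> d i = k}"
proof -
  have "char_poly (mat_diag n d) = (\<Prod>a\<leftarrow>diag_mat (mat_diag n d). [:- a, 1:])"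
    by (rule char_poly_upper_triangular[of _ n]) (auto simp: mat_diag_def)
  also have "diag_mat (mat_diag n d) = map d [0..<n]"
    by (auto simp: diag_mat_def mat_diag_def)
  finally have cp: "char_poly (mat_diag n d) = (\<Prod>a\<leftarrow>map d [0..<n]. [:- a, 1:])" .
  have "order k (\<Prod>a\<leftarrow>map d [0..<n]. [:- a, 1:]) = card {i. i < n \<and> d i = k}"
  proof (induction n)
    case (Suc n)
    have "(\<Prod>a\<leftarrow>map d [0..<n]. [:- a, 1:]) \<noteq> 0"
      by (auto simp: prod_list_zero_iff)
    then have "order k (\<Prod>a\<leftarrow>map d [0..<Suc n]. [:- a, 1:]) =
      card {i. i < n \<and> d i = k} + order k [:- d n, 1:]"
      using Suc by (simp add: order_mult del: mult_pCons_left mult_pCons_right)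
    also have "order k [:- d n, 1:] = (if d n = k then 1 else 0)"
      using order_linear_power[of k "- d n" 1] by auto
    also have "card {i. i < n \<and> d i = k} + (if d n = k then 1 else 0) = card {i. i < Suc n \<and> d i = k}"
    proof (cases "d n = k")
      case True
      then have "{i. i < Suc n \<and> d i = k} = insert n {i. i < n \<and> d i = k}"
        by (auto simp: less_Suc_eq)
      then show ?thesis using True by simp
    next
      case False
      then have "{i. i < Suc n \<and> d i = k} = {i. i < n \<and> d i = k}"
        by (auto simp: less_Suc_eq)
      then show ?thesis using False by simp
    qed
    finally show ?case .
  qed (simp add: order_1_eq_0)
  then show ?thesis by (simp only: cp)
qed

lemma inertia_similar_mat_diag:
  assumes A: "A \<in> carrier_mat n n" and sim: "similar_mat A (mat_diag n d)"
  shows "inertia A =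
    (card {i. i < n \<and> d i > 0}, card {i. i < n \<and> d i < 0}, card {i. i < n \<and> d i = 0})"
proof -
  have ord: "order k (char_poly A) = card {i. i < n \<and> d i = k}" for k
    using char_poly_similar[OF sim] order_char_poly_mat_diag by simp
  have "char_poly A \<noteq> 0" using degree_monic_char_poly[OF A] by auto
  then have "eigenvalue A k \<longleftrightarrow> order k (char_poly A) \<noteq> 0" for k
    by (simp add: eigenvalue_root_char_poly[OF A] order_root)
  then have ev: "eigenvalue A k \<longleftrightarrow> k \<in> d ` {..<n}" for k
    by (auto simp: ord)
  have "(\<Sum>k | eigenvalue A k \<and> R k. order k (char_poly A)) = card {i. i < n \<and> R (d i)}" for R
  proof -
    let ?S = "{i. i < n \<and> R (d i)}"
    \<comment> \<open>\<open>inertia\<close> sums over distinct eigenvalues, so the indices are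
      grouped by their value under \<open>d\<close>.\<close>
    have "card ?S = (\<Sum>k\<in>d ` ?S. \<Sum>i | i \<in> ?S \<and> d i = k. 1)"
      by (subst sum.image_gen[symmetric]) simp_all
    also have "d ` ?S = {k. eigenvalue A k \<and> R k}" by (auto simp: ev)
    also have "(\<Sum>k | eigenvalue A k \<and> R k. \<Sum>i | i \<in> ?S \<and> d i = k. 1) =
      (\<Sum>k | eigenvalue A k \<and> R k. order k (char_poly A))"
      by (rule sum.cong) (auto simp: ord intro!: arg_cong[of _ _ card])
    finally show ?thesis by simp
  qed
  then show ?thesis by (simp only: inertia_def)
qed

text \<open>Two positive eigenvalues would give a plane on which the form is positive definite, and
  such a plane meets the hyperplane orthogonal to \<open>w\<close> in a nonzero vector; the vector
  \<open>x\<close> rules out having none. The kernel is spanned by \<open>z\<close>, where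
  \<open>z\<close> = 0 is allowed so that both parities of the helm graph are covered at once. The
  negative eigenvalues are what is left of \<open>n\<close>.\<close>

theorem inertia_one_positive:
  fixes A :: "real mat"
  assumes A: "A \<in> carrier_mat n n" "A\<^sup>T = A"
    and w: "w \<in> carrier_vec n" "\<And>x. x \<in> carrier_vec n \<Longrightarrow> w \<bullet> x = 0 \<Longrightarrow> x \<bullet> (A *\<^sub>v x) \<le> 0"
    and x: "x \<in> carrier_vec n" "x \<bullet> (A *\<^sub>v x) > 0"
    and z: "z \<in> carrier_vec n" "A *\<^sub>v z = 0\<^sub>v n"
    and ker: "\<And>y. y \<in> carrier_vec n \<Longrightarrow> A *\<^sub>v y = 0\<^sub>v n \<Longrightarrow> \<exists>c. y = c \<cdot>\<^sub>v z"
  shows "inertia A = (if z = 0\<^sub>v n then (1, n - 1, 0) else (1, n - 2, 1))"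
proof -
  obtain P d where P: "P \<in> carrier_mat n n" "P\<^sup>T * P = 1\<^sub>m n"
    and PAP: "P\<^sup>T * A * P = mat_diag n d"
    using real_spectral_theorem[OF A] by blast
  have PT: "P\<^sup>T \<in> carrier_mat n n" using P by simp
  have PPT: "P * P\<^sup>T = 1\<^sub>m n"
    by (rule mat_mult_left_right_inverse[OF PT P])
  have PTA: "P\<^sup>T * A \<in> carrier_mat n n" using PT A by simp
  note assoc = assoc_mult_mat[of _ n n _ n _ n]
  have "P * mat_diag n d = (P * P\<^sup>T) * (A * P)"
    using P(1) A PT by (simp add: PAP[symmetric] assoc)
  then have AP: "A * P = P * mat_diag n d" using A P by (simp add: PPT)
  have Aeq: "A = P * mat_diag n d * P\<^sup>T"
    using P(1) PT A by (simp add: AP[symmetric] assoc PPT)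
  have "similar_mat A (mat_diag n d)"
    unfolding similar_mat_def
    using similar_mat_witI[OF PPT P(2) Aeq A(1) _ P(1) PT] by auto
  note inertia = inertia_similar_mat_diag[OF A(1) this]

  have diag: "mat_diag n d *\<^sub>v y = vec n (\<lambda>i. d i * y $ i)" if "y \<in> carrier_vec n" for y
    by (rule eq_vecI) (use that in \<open>auto simp: mat_diag_def scalar_prod_def if_distrib[of "\<lambda>t. t * _"] cong: if_cong\<close>)
  have Py: "P *\<^sub>v y \<in> carrier_vec n" if "y \<in> carrier_vec n" for y
    using P that by simp
  have PPy: "P\<^sup>T *\<^sub>v (P *\<^sub>v y) = y" if "y \<in> carrier_vec n" for y
    using P PT that by (simp add: assoc_mult_mat_vec[symmetric, of _ n n _ n])
  have iso: "(P *\<^sub>v y) \<bullet> (P *\<^sub>v y') = y \<bullet> y'" if "y \<in> carrier_vec n" "y' \<in> carrier_vec n" for y y'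
    using transpose_vec_mult_scalar[OF P(1) that(2) Py[OF that(1)]] PPy[OF that(1)] by simp
  have APy: "A *\<^sub>v (P *\<^sub>v y) = P *\<^sub>v vec n (\<lambda>i. d i * y $ i)" if "y \<in> carrier_vec n" for y
  proof -
    have "A *\<^sub>v (P *\<^sub>v y) = (A * P) *\<^sub>v y" using A P that by simp
    also have "\<dots> = P *\<^sub>v (mat_diag n d *\<^sub>v y)"
      unfolding AP using P that by (simp add: assoc_mult_mat_vec[of _ n n _ n])
    finally show ?thesis using that by (simp add: diag)
  qed
  have form: "(P *\<^sub>v y) \<bullet> (A *\<^sub>v (P *\<^sub>v y)) = (\<Sum>i<n. d i * (y $ i)\<^sup>2)"
    if "y \<in> carrier_vec n" for y
  proof -
    have "(P *\<^sub>v y) \<bullet> (A *\<^sub>v (P *\<^sub>v y)) = y \<bullet> vec n (\<lambda>i. d i * y $ i)"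
      unfolding APy[OF that] by (rule iso) (use that in auto)
    then show ?thesis
      by (simp add: scalar_prod_def atLeast0LessThan power2_eq_square mult.left_commute)
  qed
  define u where "u = P\<^sup>T *\<^sub>v w"
  have wP: "w \<bullet> (P *\<^sub>v y) = u \<bullet> y" if "y \<in> carrier_vec n" for y
    using transpose_vec_mult_scalar[OF P(1) that w(1)] by (simp add: u_def)
  have u: "u \<in> carrier_vec n" using PT w by (simp add: u_def)

  have le1: "i = j" if "i < n" "j < n" "d i > 0" "d j > 0" for i j
  proof (rule ccontr)
    assume "i \<noteq> j"
    \<comment> \<open>A nonzero combination of the two eigenvectors orthogonal to \<open>w\<close>;
      in eigencoordinates \<open>w\<close> becomes \<open>u\<close>. If both coordinates of
      \<open>u\<close> vanish, any nonzero pair serves.\<close>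
    obtain s t where st: "s \<noteq> 0 \<or> t \<noteq> (0::real)" "s * u $ i + t * u $ j = 0"
    proof (cases "u $ i = 0 \<and> u $ j = 0")
      case True
      then show ?thesis using that[of 1 1] by simp
    next
      case False
      then show ?thesis using that[of "u $ j" "- u $ i"] by auto
    qed
    define y where "y = vec n (\<lambda>l. if l = i then s else if l = j then t else 0)"
    have y: "y \<in> carrier_vec n" by (simp add: y_def)
    have sub: "{i, j} \<subseteq> {..<n}" using that by auto
    have "u \<bullet> y = (\<Sum>l\<in>{i, j}. u $ l * y $ l)"
      unfolding scalar_prod_def
      by (rule sum.mono_neutral_right) (use that in \<open>auto simp: y_def\<close>)
    also have "\<dots> = 0" using st \<open>i \<noteq> j\<close> that by (simp add: y_def mult.commute)
    finally have "(P *\<^sub>v y) \<bullet> (A *\<^sub>v (P *\<^sub>v y)) \<le> 0"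
      using w(2)[OF Py[OF y]] wP[OF y] by simp
    then have "(\<Sum>l<n. d l * (y $ l)\<^sup>2) \<le> 0" using form[OF y] by simp
    also have "(\<Sum>l<n. d l * (y $ l)\<^sup>2) = (\<Sum>l\<in>{i, j}. d l * (y $ l)\<^sup>2)"
      by (rule sum.mono_neutral_right) (use that in \<open>auto simp: y_def\<close>)
    also have "\<dots> = d i * s\<^sup>2 + d j * t\<^sup>2" using \<open>i \<noteq> j\<close> that by (simp add: y_def)
    also have "\<dots> > 0"
      using st(1) that(3,4) by (auto intro: add_pos_nonneg add_nonneg_pos)
    finally show False by simp
  qed
  have ex1: "\<exists>i<n. d i > 0"
  proof (rule ccontr)
    assume "\<not> ?thesis"
    then have neg: "d i \<le> 0" if "i < n" for i using that by force
    have y: "P\<^sup>T *\<^sub>v x \<in> carrier_vec n" using PT x by simp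
    have "P *\<^sub>v (P\<^sup>T *\<^sub>v x) = x"
      using P PT x PPT by (simp add: assoc_mult_mat_vec[symmetric, of _ n n _ n])
    then have "x \<bullet> (A *\<^sub>v x) = (\<Sum>i<n. d i * ((P\<^sup>T *\<^sub>v x) $ i)\<^sup>2)" using form[OF y] by simp
    also have "\<dots> \<le> 0" by (intro sum_nonpos mult_nonpos_nonneg) (use neg in auto)
    finally show False using x by simp
  qed
  then obtain i1 where "i1 < n" "d i1 > 0" by blast
  then have "{i. i < n \<and> d i > 0} = {i1}" using le1 by auto
  then have pos: "card {i. i < n \<and> d i > 0} = 1" by simp

  have kerd: "P *\<^sub>v unit_vec n i \<in> carrier_vec n" "A *\<^sub>v (P *\<^sub>v unit_vec n i) = 0\<^sub>v n"
    if "i < n" "d i = 0" for i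
  proof -
    have "vec n (\<lambda>l. d l * (unit_vec n i :: real vec) $ l) = 0\<^sub>v n"
      using that by (auto simp: unit_vec_def)
    then show "A *\<^sub>v (P *\<^sub>v unit_vec n i) = 0\<^sub>v n"
      using P by (auto simp: APy intro!: eq_vecI)
  qed (use P in simp)
  have unit: "(unit_vec n i :: real vec) \<bullet> unit_vec n j = (if i = j then 1 else 0)"
    if "i < n" "j < n" for i j
    using that by (simp add: scalar_prod_left_unit)
  have zero: "card {i. i < n \<and> d i = 0} = (if z = 0\<^sub>v n then 0 else 1)"
  proof (cases "z = 0\<^sub>v n")
    case True
    have "d i \<noteq> 0" if "i < n" for i
    proof
      assume "d i = 0"
      then have "P *\<^sub>v unit_vec n i = 0\<^sub>v n" using ker kerd[OF that] True by force
      then show False using iso[of "unit_vec n i" "unit_vec n i"] unit[OF that that] by simp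
    qed
    then have "{i. i < n \<and> d i = 0} = {}" by auto
    then show ?thesis using True by simp
  next
    case False
    define y where "y = P\<^sup>T *\<^sub>v z"
    have y: "y \<in> carrier_vec n" "P *\<^sub>v y = z"
      using P PT z PPT by (simp_all add: y_def assoc_mult_mat_vec[symmetric, of _ n n _ n])
    have "\<exists>i<n. d i = 0"
    proof (rule ccontr)
      assume *: "\<not> ?thesis"
      define dy where "dy = vec n (\<lambda>i. d i * y $ i)"
      have "P *\<^sub>v dy = 0\<^sub>v n" using APy[OF y(1)] y(2) z(2) by (simp add: dy_def)
      then have "dy = P\<^sup>T *\<^sub>v 0\<^sub>v n" using PPy[of dy] by (simp add: dy_def)
      also have "\<dots> = 0\<^sub>v n" by (rule eq_vecI) (use P in auto)
      finally have dy: "dy = 0\<^sub>v n" .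
      have "d i * y $ i = 0" if "i < n" for i
      proof -
        have "d i * y $ i = dy $ i" using that by (simp add: dy_def)
        then show ?thesis using that by (simp add: dy)
      qed
      then have "y = 0\<^sub>v n" using y(1) * by (intro eq_vecI) auto
      then have "z = P *\<^sub>v 0\<^sub>v n" using y(2) by simp
      also have "\<dots> = 0\<^sub>v n" by (rule eq_vecI) (use P in auto)
      finally show False using False by simp
    qed
    then obtain i0 where i0: "i0 < n" "d i0 = 0" by blast
    have "i = i0" if i: "i < n" "d i = 0" for i
    proof (rule ccontr)
      assume ne: "i \<noteq> i0"
      obtain a where a: "P *\<^sub>v unit_vec n i = a \<cdot>\<^sub>v z" using ker[OF kerd[OF i]] ..
      obtain b where b: "P *\<^sub>v unit_vec n i0 = b \<cdot>\<^sub>v z" using ker[OF kerd[OF i0]] ..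
      have zz: "(s \<cdot>\<^sub>v z) \<bullet> (t \<cdot>\<^sub>v z) = s * (t * (z \<bullet> z))" for s t
        using z by (simp add: smult_scalar_prod_distrib[of _ n] scalar_prod_smult_distrib[of _ n])
      \<comment> \<open>Two orthonormal vectors cannot both be multiples of \<open>z\<close>: the
        unit norms make \<open>a\<close>, \<open>b\<close> and the square norm of \<open>z\<close>
        nonzero, the orthogonality makes their product zero.\<close>
      have "a * (a * (z \<bullet> z)) = 1" "b * (b * (z \<bullet> z)) = 1" "a * (b * (z \<bullet> z)) = 0"
        using iso[of "unit_vec n i" "unit_vec n i"] iso[of "unit_vec n i0" "unit_vec n i0"]
          iso[of "unit_vec n i" "unit_vec n i0"] unit i i0 ne
        by (simp_all add: a b zz)
      then show False by auto
    qed
    then have "{i. i < n \<and> d i = 0} = {i0}" using i0 by blast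
    then show ?thesis using False by simp
  qed
  have "{..<n} = {i. i < n \<and> d i > 0} \<union> {i. i < n \<and> d i < 0} \<union> {i. i < n \<and> d i = 0}"
    by auto
  then have "n = card ({i. i < n \<and> d i > 0} \<union> {i. i < n \<and> d i < 0} \<union> {i. i < n \<and> d i = 0})"
    by (metis card_lessThan)
  also have "\<dots> = card {i. i < n \<and> d i > 0} + card {i. i < n \<and> d i < 0} + card {i. i < n \<and> d i = 0}"
    by (subst card_Un_disjoint; (subst card_Un_disjoint)?) auto
  finally show ?thesis using pos zero by (auto simp: inertia)
qed

section \<open>Distances in the helm graph\<close>

text \<open>A potential that vanishes at \<open>u\<close> and grows by at most 1 along each arc
  bounds the length of every walk from \<open>u\<close> from below; a single walk attaining the
  bound fixes the distance.\<close>

lemma graph_dist_eqI: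
  fixes f :: "'a \<Rightarrow> nat"
  assumes G: "pair_wf_digraph G"
    and p: "pre_digraph.awalk (with_proj G) u p v" "length p = f v"
    and f: "f u = 0" "\<And>x y. (x, y) \<in> parcs G \<Longrightarrow> f y \<le> f x + 1"
  shows "graph_dist G u v = f v"
proof -
  interpret pair_wf_digraph G by (fact G)
  have cost: "awalk_cost (\<lambda>_. 1) q = length q" for q :: "('a \<times> 'a) list"
    by (induction q) auto
  \<comment> \<open>The start of the walk is kept general, since the induction strips arcs from the
    front.\<close>
  have "f v \<le> f w + length q" if "awalk w q v" for w q
    using that
  proof (induction q arbitrary: w)
    case (Cons e q)
    then have e: "(w, snd e) \<in> parcs G" and "awalk (snd e) q v"
      by (cases e; auto simp: awalk_Cons_iff)+
    then have "f v \<le> f (snd e) + length q" using Cons.IH by blast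
    then show ?case using f(2)[OF e] by simp
  qed (auto simp: awalk_Nil_iff)
  then have lower: "ereal (f v) \<le> \<mu> (\<lambda>_. 1) u v"
    unfolding \<mu>_def cost by (intro INF_greatest) (use f(1) in force)
  have "\<mu> (\<lambda>_. 1) u v \<le> ereal (f v)"
    using min_cost_le_walk_cost[OF p(1), of "\<lambda>_. 1"] p(2) by (simp add: cost)
  with lower have "\<mu> (\<lambda>_. 1) u v = ereal (f v)" by (rule antisym[rotated])
  then show ?thesis by (simp add: graph_dist_def)
qed

section \<open>The rim cycle and a closed form for the distances\<close>

definition cyc_succ :: "nat \<Rightarrow> nat \<Rightarrow> nat" where
  "cyc_succ m i = (if i = m then 1 else i + 1)"

lemma bij_betw_cyc_succ: "bij_betw (cyc_succ m) {1..m} {1..m}"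
proof (rule bij_betw_byWitness[where f' = "\<lambda>i. if i = 1 then m else i - 1"])
qed (auto simp: cyc_succ_def)

lemma sum_cyc_succ: "(\<Sum>i = 1..m. f (cyc_succ m i)) = (\<Sum>i = 1..m. f i)"
  by (rule sum.reindex_bij_betw[OF bij_betw_cyc_succ])

lemma cyc_succ_mem: "i \<in> {1..m} \<Longrightarrow> cyc_succ m i \<in> {1..m}"
  by (auto simp: cyc_succ_def)

primrec base :: "helm_vertex \<Rightarrow> nat" where
  "base (Wheel i) = i" | "base (Pendant i) = i"

primrec height :: "helm_vertex \<Rightarrow> nat" where
  "height (Wheel i) = 0" | "height (Pendant i) = 1"

text \<open>The hub joins any two wheel vertices within two steps, so only equality and adjacency
  have to be told apart.\<close>

definition wheel_dist :: "nat \<Rightarrow> nat \<Rightarrow> nat \<Rightarrow> nat" where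
  "wheel_dist m i j = (if i = j then 0
    else if i = 0 \<or> j = 0 \<or> j = cyc_succ m i \<or> i = cyc_succ m j then 1 else 2)"

text \<open>A pendant vertex has a single neighbour, so a path between distinct vertices passes
  through their bases. Equality is treated apart because the sum would give 2 for a pendant vertex
  and itself.\<close>

definition helm_dist :: "nat \<Rightarrow> helm_vertex \<Rightarrow> helm_vertex \<Rightarrow> nat" where
  "helm_dist m u v =
    (if u = v then 0 else height u + height v + wheel_dist m (base u) (base v))"

lemma helm_dist_commute: "helm_dist m u v = helm_dist m v u"
  by (auto simp: helm_dist_def wheel_dist_def)

text \<open>The closing edge of the rim is absorbed into \<open>cyc_succ\<close>, so that every rim
  index contributes one rim edge, one spoke and one pendant edge.\<close>

lemma parcs_helm_graph:
  assumes "n \<ge> 2"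
  shows "parcs (helm_graph n) =
    (\<Union>i\<in>{1..n - 1}. let E = {(Wheel i, Wheel (cyc_succ (n - 1) i)), (Wheel 0, Wheel i), (Wheel i, Pendant i)}
      in E \<union> E\<inverse>)"
proof -
  have "helm_edges n =
    (\<Union>i\<in>{1..n - 1}. {(Wheel i, Wheel (cyc_succ (n - 1) i)), (Wheel 0, Wheel i), (Wheel i, Pendant i)})"
    using assms by (auto simp: helm_edges_def wheel_edges_def cyc_succ_def split: if_splits)
  then show ?thesis by (auto simp: helm_graph_def Let_def)
qed

lemma set_helm_vertices: "n \<ge> 1 \<Longrightarrow>
  set (helm_vertices n) = insert (Wheel 0) (\<Union>i\<in>{1..n - 1}. {Wheel i, Pendant i})"
  by (auto simp: helm_vertices_def image_iff)

lemma wheel_dist_le_2: "wheel_dist m i j \<le> 2"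
  by (simp add: wheel_dist_def)

text \<open>No wheel distance exceeds 2, so the bound is automatic unless \<open>k\<close> =
  \<open>i\<close>, where it is the hypothesis.\<close>

lemma wheel_dist_step: "wheel_dist m i j \<le> 1 \<Longrightarrow> wheel_dist m k j \<le> wheel_dist m k i + 1"
  using wheel_dist_le_2[of m k j] by (cases "k = i") (auto simp: wheel_dist_def)

text \<open>This makes \<open>helm_dist\<close> from a fixed vertex a potential for
  \<open>graph_dist_eqI\<close>. An arc either joins two wheel vertices or runs along a pendant edge
  in one of its two directions.\<close>

lemma helm_dist_arc_le:
  assumes n: "n \<ge> 4" and arc: "(x, y) \<in> parcs (helm_graph n)"
  shows "helm_dist (n - 1) u y \<le> helm_dist (n - 1) u x + 1"
proof -
  define m where "m = n - 1"
  have "n \<ge> 2" using n by simp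
  then consider i j where "x = Wheel i" "y = Wheel j" "wheel_dist m i j \<le> 1"
    | i where "x = Wheel i" "y = Pendant i" | i where "x = Pendant i" "y = Wheel i"
    using arc by (auto simp: parcs_helm_graph m_def Let_def wheel_dist_def split: if_splits)
  then have "helm_dist m u y \<le> helm_dist m u x + 1"
  proof cases
    case 1
    then show ?thesis
      using wheel_dist_step[of m i j "base u"] by (auto simp: helm_dist_def)
  next
    case 2
    then show ?thesis by (auto simp: helm_dist_def wheel_dist_def)
  next
    case 3
    then show ?thesis by (auto simp: helm_dist_def wheel_dist_def)
  qed
  then show ?thesis by (simp add: m_def)
qed

text \<open>The walk attaining the bound descends from \<open>u\<close> to its base, crosses the
  wheel and climbs to \<open>v\<close>.\<close>

lemma helm_dist_walk:
  assumes n: "n \<ge> 4" and uv: "u \<in> set (helm_vertices n)" "v \<in> set (helm_vertices n)"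
  shows "\<exists>p. pre_digraph.awalk (with_proj (helm_graph n)) u p v \<and> length p = helm_dist (n - 1) u v"
proof -
  interpret pair_graph "helm_graph n" using n by (rule pair_graph_helm_graph)
  define m where "m = n - 1"
  define W where "W k x y \<longleftrightarrow> (\<exists>p. awalk x p y \<and> length p = k)" for k x y
  have verts: "pverts (helm_graph n) = insert (Wheel 0) (\<Union>i\<in>{1..m}. {Wheel i, Pendant i})"
    using n set_helm_vertices[of n] by (simp add: helm_graph_def m_def)
  have W0: "W 0 x x" if "x \<in> pverts (helm_graph n)" for x
    using that by (auto simp: W_def awalk_Nil_iff)
  have W1: "W 1 x y" if "(x, y) \<in> parcs (helm_graph n)" for x y
    using arc_implies_awalk[of "(x, y)"] that by (auto simp: W_def intro!: exI[of _ "[(x, y)]"])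
  have trans: "W (k + l) x z" if xy: "W k x y" and yz: "W l y z" for k l x y z
  proof -
    obtain p q where "awalk x p y" "length p = k" "awalk y q z" "length q = l"
      using xy yz by (auto simp: W_def)
    then have "awalk x (p @ q) z" "length (p @ q) = k + l" by (auto intro: awalk_appendI)
    then show ?thesis unfolding W_def by blast
  qed
  have arcs: "(Wheel 0, Wheel i) \<in> parcs (helm_graph n)" "(Wheel i, Wheel 0) \<in> parcs (helm_graph n)"
    "(Wheel i, Pendant i) \<in> parcs (helm_graph n)" "(Pendant i, Wheel i) \<in> parcs (helm_graph n)"
    "(Wheel i, Wheel (cyc_succ m i)) \<in> parcs (helm_graph n)"
    "(Wheel (cyc_succ m i), Wheel i) \<in> parcs (helm_graph n)"
    if "1 \<le> i" "i \<le> m" for i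
    using that n by (auto simp: parcs_helm_graph Let_def m_def)
  have wheel: "W (wheel_dist m i j) (Wheel i) (Wheel j)" if ij: "i \<le> m" "j \<le> m" for i j
  proof -
    have V: "Wheel k \<in> pverts (helm_graph n)" if "k \<le> m" for k
      using that by (cases "k = 0") (auto simp: verts)
    consider "i = j" | "i \<noteq> j" "i = 0 \<or> j = 0 \<or> j = cyc_succ m i \<or> i = cyc_succ m j"
      | "i \<noteq> j" "\<not> (i = 0 \<or> j = 0 \<or> j = cyc_succ m i \<or> i = cyc_succ m j)"
      by blast
    then show ?thesis
    proof cases
      case 1
      then show ?thesis using W0[OF V] ij by (simp add: wheel_dist_def)
    next
      case 2
      then have "(Wheel i, Wheel j) \<in> parcs (helm_graph n)"
        using arcs[of i] arcs[of j] ij by (cases "i = 0"; cases "j = 0") auto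
      then show ?thesis using W1 2 by (simp add: wheel_dist_def)
    next
      case 3
      \<comment> \<open>Distinct nonadjacent rim vertices are joined through the hub.\<close>
      have "W (1 + 1) (Wheel i) (Wheel j)"
        by (rule trans[OF W1[OF arcs(2)] W1[OF arcs(1)]]) (use 3 ij in auto)
      then show ?thesis using 3 by (simp add: wheel_dist_def numeral_2_eq_2)
    qed
  qed
  have up: "W (height x) (Wheel (base x)) x" and down: "W (height x) x (Wheel (base x))"
    and base: "base x \<le> m"
    if "x \<in> set (helm_vertices n)" for x
    using that arcs W0 W1 n by (auto simp: set_helm_vertices verts m_def)
  have "W (height u + wheel_dist m (base u) (base v) + height v) u v"
    by (rule trans[OF trans[OF down[OF uv(1)] wheel[OF base[OF uv(1)] base[OF uv(2)]]] up[OF uv(2)]])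
  \<comment> \<open>For \<open>u\<close> = \<open>v\<close> the composed walk can be too long, and
    the empty walk replaces it.\<close>
  then have "W (helm_dist m u v) u v"
    using W0 uv by (auto simp: helm_dist_def ac_simps helm_graph_def)
  then show ?thesis by (simp add: W_def m_def)
qed

lemma graph_dist_helm_graph:
  assumes n: "n \<ge> 4" and uv: "u \<in> set (helm_vertices n)" "v \<in> set (helm_vertices n)"
  shows "graph_dist (helm_graph n) u v = helm_dist (n - 1) u v"
proof -
  interpret pair_graph "helm_graph n" using n by (rule pair_graph_helm_graph)
  obtain p where "awalk u p v" "length p = helm_dist (n - 1) u v"
    using helm_dist_walk[OF assms] by blast
  moreover have "helm_dist (n - 1) u u = 0" by (simp add: helm_dist_def)
  moreover have "pair_wf_digraph (helm_graph n)" by unfold_locales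
  ultimately show ?thesis using graph_dist_eqI helm_dist_arc_le[OF n] by metis
qed

section \<open>The distance matrix of the helm graph\<close>

text \<open>For $m = n - 1 \geq 3$ these are the entries of the circulant matrix $S$.\<close>

definition cyc_gram :: "nat \<Rightarrow> nat \<Rightarrow> nat \<Rightarrow> real" where
  "cyc_gram m i j = 2 * of_bool (i = j) + of_bool (j = cyc_succ m i) + of_bool (i = cyc_succ m j)"

lemma sum_mult_of_bool_eq:
  "finite A \<Longrightarrow> (\<Sum>j\<in>A. (f j :: real) * of_bool (j = i)) = (if i \<in> A then f i else 0)"
  "finite A \<Longrightarrow> (\<Sum>j\<in>A. (f j :: real) * of_bool (i = j)) = (if i \<in> A then f i else 0)"
  by (simp_all add: of_bool_def if_distrib[of "\<lambda>t. _ * t"] cong: if_cong)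

text \<open>The predecessor term stays an indicator sum: later it is evaluated by exchanging sums or
  by reindexing, without a predecessor function.\<close>

lemma cyc_gram_row:
  assumes i: "i \<in> {1..m}"
  shows "(\<Sum>j = 1..m. cyc_gram m i j * r j) =
    2 * r i + r (cyc_succ m i) + (\<Sum>j = 1..m. r j * of_bool (i = cyc_succ m j))"
proof -
  have "(\<Sum>j = 1..m. cyc_gram m i j * r j) =
    (\<Sum>j = 1..m. 2 * r j * of_bool (i = j)) + (\<Sum>j = 1..m. r j * of_bool (j = cyc_succ m i)) +
    (\<Sum>j = 1..m. r j * of_bool (i = cyc_succ m j))"
    by (simp add: cyc_gram_def algebra_simps sum.distrib)
  then show ?thesis
    using i cyc_succ_mem[OF i] by (simp only: sum_mult_of_bool_eq finite_atLeastAtMost if_True)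
qed

text \<open>S is 2I plus the cyclic shift and its transpose. The two shift terms contribute equally
  to the form, and shifting the index in one of the two copies of the sum of squares completes the
  square.\<close>

lemma cyc_gram_form:
  "(\<Sum>i = 1..m. r i * (\<Sum>j = 1..m. cyc_gram m i j * r j)) = (\<Sum>i = 1..m. (r i + r (cyc_succ m i))\<^sup>2)"
proof -
  let ?s = "cyc_succ m"
  have "(\<Sum>i = 1..m. r i * (\<Sum>j = 1..m. cyc_gram m i j * r j)) =
    (\<Sum>i = 1..m. 2 * (r i)\<^sup>2 + r i * r (?s i) + (\<Sum>j = 1..m. r i * r j * of_bool (i = ?s j)))"
  proof (rule sum.cong)
    fix i assume "i \<in> {1..m}"
    then have "r i * (\<Sum>j = 1..m. cyc_gram m i j * r j) =
      r i * (2 * r i + r (?s i) + (\<Sum>j = 1..m. r j * of_bool (i = ?s j)))"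
      by (simp only: cyc_gram_row)
    then show "r i * (\<Sum>j = 1..m. cyc_gram m i j * r j) =
      2 * (r i)\<^sup>2 + r i * r (?s i) + (\<Sum>j = 1..m. r i * r j * of_bool (i = ?s j))"
      by (simp only: distrib_left sum_distrib_left power2_eq_square mult.assoc mult.left_commute[of _ 2])
  qed simp
  also have "\<dots> = 2 * (\<Sum>i = 1..m. (r i)\<^sup>2) + (\<Sum>i = 1..m. r i * r (?s i)) +
    (\<Sum>i = 1..m. \<Sum>j = 1..m. r i * r j * of_bool (i = ?s j))"
    by (simp only: sum.distrib sum_distrib_left)
  also have "(\<Sum>i = 1..m. \<Sum>j = 1..m. r i * r j * of_bool (i = ?s j)) =
    (\<Sum>j = 1..m. \<Sum>i = 1..m. r i * r j * of_bool (i = ?s j))"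
    by (rule sum.swap)
  also have "\<dots> = (\<Sum>j = 1..m. r j * r (?s j))"
  proof (rule sum.cong)
    fix j assume "j \<in> {1..m}"
    then show "(\<Sum>i = 1..m. r i * r j * of_bool (i = ?s j)) = r j * r (?s j)"
      using cyc_succ_mem by (simp only: sum_mult_of_bool_eq finite_atLeastAtMost if_True mult.commute)
  qed simp
  finally have "(\<Sum>i = 1..m. r i * (\<Sum>j = 1..m. cyc_gram m i j * r j)) =
    (\<Sum>i = 1..m. (r i)\<^sup>2) + (\<Sum>i = 1..m. (r i)\<^sup>2) + 2 * (\<Sum>i = 1..m. r i * r (?s i))"
    by simp
  also have "\<dots> = (\<Sum>i = 1..m. (r i)\<^sup>2) + (\<Sum>i = 1..m. (r (?s i))\<^sup>2) + 2 * (\<Sum>i = 1..m. r i * r (?s i))"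
    by (simp only: sum_cyc_succ[of "\<lambda>i. (r i)\<^sup>2" m])
  also have "\<dots> = (\<Sum>i = 1..m. (r i + r (?s i))\<^sup>2)"
    by (simp add: power2_sum sum.distrib sum_distrib_left mult.assoc)
  finally show ?thesis .
qed

lemma cyc_gram_alternating:
  assumes alt: "\<And>i. i \<in> {1..m} \<Longrightarrow> r (cyc_succ m i) = - r i" and i: "i \<in> {1..m}"
  shows "(\<Sum>j = 1..m. cyc_gram m i j * r j) = 0"
proof -
  let ?s = "cyc_succ m"
  \<comment> \<open>Writing \<open>r j\<close> as minus its value at the successor makes the summand
    a function of the successor alone, so reindexing applies.\<close>
  have "(\<Sum>j = 1..m. r j * of_bool (i = ?s j)) = (\<Sum>j = 1..m. - r (?s j) * of_bool (i = ?s j))"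
    by (rule sum.cong) (simp_all only: alt minus_minus)
  also have "\<dots> = (\<Sum>j = 1..m. - r j * of_bool (i = j))"
    by (rule sum_cyc_succ)
  also have "\<dots> = - r i"
    using i by (simp only: sum_mult_of_bool_eq finite_atLeastAtMost if_True)
  finally show ?thesis
    using alt[OF i] by (simp only: cyc_gram_row[OF i])
qed

lemma cyc_gram_same: "m \<ge> 2 \<Longrightarrow> cyc_gram m i i = 2"
  by (auto simp: cyc_gram_def cyc_succ_def)

lemma wheel_dist_0:
  "wheel_dist m 0 j = (if j = 0 then 0 else 1)" "wheel_dist m j 0 = (if j = 0 then 0 else 1)"
  by (auto simp: wheel_dist_def)

text \<open>For m >= 3 the two rim neighbours of a vertex are distinct, so the entries 2, 1, 0 of S
  match the distances 0, 1, 2. For m = 2 both indicators would hit the same entry.\<close>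

lemma wheel_dist_cyc_gram:
  assumes "m \<ge> 3" "i \<in> {1..m}" "j \<in> {1..m}"
  shows "real (wheel_dist m i j) = 2 - cyc_gram m i j"
  using assms by (auto simp: wheel_dist_def cyc_gram_def cyc_succ_def split: if_splits)

text \<open>Position 0 is the hub, position i is v_i and position m + i is u_i, so the rim and
  pendant blocks both run over 1..m.\<close>

lemma sum_helm_index:
  fixes f :: "nat \<Rightarrow> real"
  shows "(\<Sum>j<2 * m + 1. f j) = f 0 + (\<Sum>j = 1..m. f j) + (\<Sum>j = 1..m. f (m + j))"
proof -
  have "{..<2 * m + 1} = {0} \<union> {1..m} \<union> (+) m ` {1..m}"
    by (auto simp: image_iff)
  then have "(\<Sum>j<2 * m + 1. f j) = (\<Sum>j\<in>{0} \<union> {1..m}. f j) + (\<Sum>j\<in>(+) m ` {1..m}. f j)"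
    by (simp only:) (rule sum.union_disjoint, auto)
  also have "(\<Sum>j\<in>(+) m ` {1..m}. f j) = (\<Sum>j = 1..m. f (m + j))"
    by (subst sum.reindex) auto
  finally show ?thesis by simp
qed

lemma all_helm_index:
  fixes R :: "nat \<Rightarrow> bool"
  shows "(\<forall>i<2 * m + 1. R i) \<longleftrightarrow> R 0 \<and> (\<forall>i\<in>{1..m}. R i \<and> R (m + i))"
proof safe
  fix i assume R: "R 0" "\<forall>i\<in>{1..m}. R i \<and> R (m + i)" and i: "i < 2 * m + 1"
  show "R i"
  proof (cases "i \<le> m")
    case True
    then show ?thesis using R by (cases "i = 0") auto
  next
    case False
    then have "i - m \<in> {1..m}" "i = m + (i - m)" using i by auto
    then show ?thesis using R by metis
  qed
qed auto

section \<open>Entries of the distance matrix, parametrised by the rim length m = n - 1\<close>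

definition helm_distance_matrix :: "nat \<Rightarrow> real mat" where
  "helm_distance_matrix m = distance_matrix (helm_graph (m + 1)) (helm_vertices (m + 1))"

context
  fixes m :: nat
  assumes m: "m \<ge> 3"
begin

lemma helm_distance_matrix_carrier:
  "helm_distance_matrix m \<in> carrier_mat (2 * m + 1) (2 * m + 1)"
  by (simp add: helm_distance_matrix_def distance_matrix_def length_helm_vertices)

lemma helm_vertices_nth:
  "helm_vertices (m + 1) ! 0 = Wheel 0"
  "i \<in> {1..m} \<Longrightarrow> helm_vertices (m + 1) ! i = Wheel i"
  "i \<in> {1..m} \<Longrightarrow> helm_vertices (m + 1) ! (m + i) = Pendant i"
  by (auto simp: helm_vertices_def nth_append simp del: upt_Suc)

lemma helm_distance_matrix_entry:
  assumes "i < 2 * m + 1" "j < 2 * m + 1"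
  shows "helm_distance_matrix m $$ (i, j) =
    helm_dist m (helm_vertices (m + 1) ! i) (helm_vertices (m + 1) ! j)"
  using assms m graph_dist_helm_graph[of "m + 1"] length_helm_vertices[of "m + 1"]
  by (simp add: helm_distance_matrix_def distance_matrix_def)

lemma helm_distance_matrix_symmetric: "(helm_distance_matrix m)\<^sup>T = helm_distance_matrix m"
  using helm_distance_matrix_carrier
  by (intro eq_matI) (auto simp: helm_distance_matrix_entry helm_dist_commute)

text \<open>The heights raise the constant 2 of \<open>wheel_dist_cyc_gram\<close> to 3 and 4. On
  the diagonal of the pendant block this alone would give 4 - 2 = 2, which the last term corrects to
  0.\<close>

lemma helm_distance_matrix_blocks:
  "helm_distance_matrix m $$ (0, 0) = 0"
  "j \<in> {1..m} \<Longrightarrow> helm_distance_matrix m $$ (0, j) = 1"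
  "j \<in> {1..m} \<Longrightarrow> helm_distance_matrix m $$ (0, m + j) = 2"
  "i \<in> {1..m} \<Longrightarrow> helm_distance_matrix m $$ (i, 0) = 1"
  "i \<in> {1..m} \<Longrightarrow> j \<in> {1..m} \<Longrightarrow> helm_distance_matrix m $$ (i, j) = 2 - cyc_gram m i j"
  "i \<in> {1..m} \<Longrightarrow> j \<in> {1..m} \<Longrightarrow> helm_distance_matrix m $$ (i, m + j) = 3 - cyc_gram m i j"
  "i \<in> {1..m} \<Longrightarrow> helm_distance_matrix m $$ (m + i, 0) = 2"
  "i \<in> {1..m} \<Longrightarrow> j \<in> {1..m} \<Longrightarrow> helm_distance_matrix m $$ (m + i, j) = 3 - cyc_gram m i j"
  "i \<in> {1..m} \<Longrightarrow> j \<in> {1..m} \<Longrightarrow>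
    helm_distance_matrix m $$ (m + i, m + j) = 4 - cyc_gram m i j - 2 * of_bool (i = j)"
  using m by (simp_all add: helm_distance_matrix_entry helm_vertices_nth[simplified] helm_dist_def
      wheel_dist_0 wheel_dist_cyc_gram cyc_gram_same)

section \<open>Action on a vector, the quadratic form and the kernel equations\<close>

context
  fixes x :: "real vec"
  assumes x: "x \<in> carrier_vec (2 * m + 1)"
begin

private abbreviation "hub \<equiv> x $ 0"
private abbreviation "rim i \<equiv> x $ i"
private abbreviation "pen i \<equiv> x $ (m + i)"
private abbreviation "Rim \<equiv> \<Sum>i = 1..m. rim i"
private abbreviation "Pen \<equiv> \<Sum>i = 1..m. pen i"
private abbreviation "G i \<equiv> \<Sum>j = 1..m. cyc_gram m i j * (rim j + pen j)"

lemma helm_mult_vec_sum: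
  assumes "i < 2 * m + 1"
  shows "(helm_distance_matrix m *\<^sub>v x) $ i = helm_distance_matrix m $$ (i, 0) * hub +
    (\<Sum>j = 1..m. helm_distance_matrix m $$ (i, j) * rim j) +
    (\<Sum>j = 1..m. helm_distance_matrix m $$ (i, m + j) * pen j)"
proof -
  have "(helm_distance_matrix m *\<^sub>v x) $ i = (\<Sum>j<2 * m + 1. helm_distance_matrix m $$ (i, j) * x $ j)"
    using assms x helm_distance_matrix_carrier
    by (auto simp: scalar_prod_def atLeast0LessThan intro!: sum.cong)
  then show ?thesis by (simp only: sum_helm_index)
qed

text \<open>All four blocks away from the hub contain the same -S, so S acts only on the sum of the
  rim and pendant parts; this is \<open>G\<close>.\<close>

lemma helm_mult_vec:
  "(helm_distance_matrix m *\<^sub>v x) $ 0 = Rim + 2 * Pen"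
  "i \<in> {1..m} \<Longrightarrow> (helm_distance_matrix m *\<^sub>v x) $ i = hub + 2 * Rim + 3 * Pen - G i"
  "i \<in> {1..m} \<Longrightarrow> (helm_distance_matrix m *\<^sub>v x) $ (m + i) =
    2 * hub + 3 * Rim + 4 * Pen - G i - 2 * pen i"
proof -
  show "(helm_distance_matrix m *\<^sub>v x) $ 0 = Rim + 2 * Pen"
    by (simp add: helm_mult_vec_sum helm_distance_matrix_blocks sum_distrib_left[symmetric])
  assume i: "i \<in> {1..m}"
  then have less: "i < 2 * m + 1" "m + i < 2 * m + 1" by auto
  show "(helm_distance_matrix m *\<^sub>v x) $ i = hub + 2 * Rim + 3 * Pen - G i"
    using i by (simp add: helm_mult_vec_sum[OF less(1)] helm_distance_matrix_blocks sum_distrib_left[symmetric]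
      left_diff_distrib distrib_left sum.distrib sum_subtractf)
  have "(\<Sum>j = 1..m. (4 - cyc_gram m i j - 2 * of_bool (i = j)) * pen j) =
    4 * Pen - (\<Sum>j = 1..m. cyc_gram m i j * pen j) - (\<Sum>j = 1..m. 2 * pen j * of_bool (i = j))"
    by (simp add: sum_distrib_left[symmetric] algebra_simps sum_subtractf)
  also have "(\<Sum>j = 1..m. 2 * pen j * of_bool (i = j)) = 2 * pen i"
    using i by (simp add: sum_mult_of_bool_eq)
  finally have e: "(\<Sum>j = 1..m. (4 - cyc_gram m i j - 2 * of_bool (i = j)) * pen j) =
    4 * Pen - (\<Sum>j = 1..m. cyc_gram m i j * pen j) - 2 * pen i" .
  have "(helm_distance_matrix m *\<^sub>v x) $ (m + i) = 2 * hub +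
    (\<Sum>j = 1..m. (3 - cyc_gram m i j) * rim j) +
    (\<Sum>j = 1..m. (4 - cyc_gram m i j - 2 * of_bool (i = j)) * pen j)"
    using i by (simp add: helm_mult_vec_sum[OF less(2)] helm_distance_matrix_blocks)
  then show "(helm_distance_matrix m *\<^sub>v x) $ (m + i) =
    2 * hub + 3 * Rim + 4 * Pen - G i - 2 * pen i"
    unfolding e
    by (simp add: sum_distrib_left[symmetric] left_diff_distrib distrib_left sum.distrib sum_subtractf)
qed

lemma helm_form:
  "x \<bullet> (helm_distance_matrix m *\<^sub>v x) =
    2 * (Rim + 2 * Pen) * (hub + Rim + Pen)
    - (\<Sum>i = 1..m. (rim i + pen i + (rim (cyc_succ m i) + pen (cyc_succ m i)))\<^sup>2)
    - 2 * (\<Sum>i = 1..m. (pen i)\<^sup>2)"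
proof -
  let ?D = "helm_distance_matrix m"
  \<comment> \<open>Opaque names keep the simplifier from distributing over the block sums; what
    remains is a polynomial identity in \<open>a\<close>, \<open>P\<close> and
    \<open>Q\<close>.\<close>
  define a P Q where "a = hub" and "P = Rim" and "Q = Pen"
  have "x \<bullet> (?D *\<^sub>v x) = (\<Sum>i<2 * m + 1. x $ i * (?D *\<^sub>v x) $ i)"
    using helm_distance_matrix_carrier by (simp add: scalar_prod_def atLeast0LessThan)
  also have "\<dots> = a * (P + 2 * Q)
      + (\<Sum>i = 1..m. rim i * (a + 2 * P + 3 * Q - G i))
      + (\<Sum>i = 1..m. pen i * (2 * a + 3 * P + 4 * Q - G i - 2 * pen i))"
    by (simp only: sum_helm_index) (simp add: helm_mult_vec a_def P_def Q_def)
  also have "(\<Sum>i = 1..m. rim i * (a + 2 * P + 3 * Q - G i)) =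
    P * (a + 2 * P + 3 * Q) - (\<Sum>i = 1..m. rim i * G i)"
    by (simp add: right_diff_distrib sum_subtractf sum_distrib_right[symmetric] P_def)
  also have "(\<Sum>i = 1..m. pen i * (2 * a + 3 * P + 4 * Q - G i - 2 * pen i)) =
    Q * (2 * a + 3 * P + 4 * Q) - (\<Sum>i = 1..m. pen i * G i) - 2 * (\<Sum>i = 1..m. (pen i)\<^sup>2)"
    by (simp add: right_diff_distrib sum_subtractf sum_distrib_right[symmetric] Q_def
        sum_distrib_left power2_eq_square mult.left_commute)
  \<comment> \<open>The terms without S satisfy a(P + 2Q) + P(a + 2P + 3Q) + Q(2a + 3P + 4Q) = 2(P +
    2Q)(a + P + Q).\<close>
  finally have "x \<bullet> (?D *\<^sub>v x) = 2 * (P + 2 * Q) * (a + P + Q)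
     - ((\<Sum>i = 1..m. rim i * G i) + (\<Sum>i = 1..m. pen i * G i)) - 2 * (\<Sum>i = 1..m. (pen i)\<^sup>2)"
    by (simp add: algebra_simps)
  also have "(\<Sum>i = 1..m. rim i * G i) + (\<Sum>i = 1..m. pen i * G i) = (\<Sum>i = 1..m. (rim i + pen i) * G i)"
    by (simp add: distrib_right sum.distrib)
  finally show ?thesis
    by (simp only: cyc_gram_form[where r = "\<lambda>i. rim i + pen i"] a_def P_def Q_def)
qed

lemma helm_kernel:
  assumes "helm_distance_matrix m *\<^sub>v x = 0\<^sub>v (2 * m + 1)"
  shows "hub = 0" and "i \<in> {1..m} \<Longrightarrow> pen i = 0" and "i \<in> {1..m} \<Longrightarrow> rim (cyc_succ m i) = - rim i"
proof -
  define r where "r i = rim i + pen i + (rim (cyc_succ m i) + pen (cyc_succ m i))" for i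
  \<comment> \<open>The hub coordinate removes the product term of the form, leaving only the two
    sums of squares.\<close>
  have 0: "Rim + 2 * Pen = 0" using helm_mult_vec(1) assms by simp
  have "(\<Sum>i = 1..m. (r i)\<^sup>2) + 2 * (\<Sum>i = 1..m. (pen i)\<^sup>2) = 0"
    using helm_form x unfolding assms 0 r_def by simp
  moreover have nn: "(\<Sum>i = 1..m. (r i)\<^sup>2) \<ge> 0" "(\<Sum>i = 1..m. (pen i)\<^sup>2) \<ge> 0"
    by (simp_all add: sum_nonneg)
  ultimately have s0: "(\<Sum>i = 1..m. (r i)\<^sup>2) = 0" "(\<Sum>i = 1..m. (pen i)\<^sup>2) = 0"
    by linarith+
  then have r: "r i = 0" and pen: "pen i = 0" if "i \<in> {1..m}" for i
    using that by (auto simp: sum_nonneg_eq_0_iff)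
  show "pen i = 0" if "i \<in> {1..m}" using pen that .
  show "rim (cyc_succ m i) = - rim i" if "i \<in> {1..m}"
    using r[OF that] pen[OF that] pen[OF cyc_succ_mem[OF that]] by (simp add: r_def)
  have 1: "1 \<in> {1..m}" using m by simp
  have Pen: "Pen = 0" using pen by simp
  \<comment> \<open>Subtracting these two coordinates cancels \<open>G 1\<close> and isolates the
    hub.\<close>
  have "hub + 2 * Rim + 3 * Pen - G 1 = 0" "2 * hub + 3 * Rim + 4 * Pen - G 1 - 2 * pen 1 = 0"
    using helm_mult_vec(2,3)[OF 1] assms m by simp_all
  then show "hub = 0" using 0 Pen pen[OF 1] by simp
qed

end

section \<open>Positive vector, explicit kernel and the inertia\<close>

lemma helm_positive_vector:
  "\<exists>x \<in> carrier_vec (2 * m + 1). x \<bullet> (helm_distance_matrix m *\<^sub>v x) > 0"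
proof
  \<comment> \<open>With ones on the rim and zeros on the pendants, hub value a gives 2m(a + m) -
    4m; a = 2 cancels the linear part and leaves 2m^2.\<close>
  define x :: "real vec" where "x = vec (2 * m + 1) (\<lambda>i. if i = 0 then 2 else if i \<le> m then 1 else 0)"
  show x: "x \<in> carrier_vec (2 * m + 1)" by (simp add: x_def)
  have v: "x $ 0 = 2" "\<And>i. i \<in> {1..m} \<Longrightarrow> x $ i = 1" "\<And>i. i \<in> {1..m} \<Longrightarrow> x $ (m + i) = 0"
    by (auto simp: x_def)
  have "x \<bullet> (helm_distance_matrix m *\<^sub>v x) = 2 * real m * (2 + real m) - 4 * real m"
    using cyc_succ_mem[of _ m] by (simp add: helm_form[OF x] v)
  also have "\<dots> > 0" using m by (simp add: algebra_simps)
  finally show "x \<bullet> (helm_distance_matrix m *\<^sub>v x) > 0" .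
qed

text \<open>For odd \<open>m\<close> the alternating signs do not close up around the rim; the vector is then zero.\<close>

definition helm_kernel_vec :: "real vec" where
  "helm_kernel_vec = vec (2 * m + 1) (\<lambda>i. if even m \<and> 1 \<le> i \<and> i \<le> m then (- 1) ^ i else 0)"

lemma helm_kernel_vec_carrier: "helm_kernel_vec \<in> carrier_vec (2 * m + 1)"
  by (simp add: helm_kernel_vec_def)

lemma helm_kernel_vec_eq_0_iff: "helm_kernel_vec = 0\<^sub>v (2 * m + 1) \<longleftrightarrow> odd m"
proof
  assume "helm_kernel_vec = 0\<^sub>v (2 * m + 1)"
  then have "helm_kernel_vec $ 1 = 0" using m by simp
  then show "odd m" using m by (auto simp: helm_kernel_vec_def)
qed (auto simp: helm_kernel_vec_def)

lemma helm_mult_kernel_vec: "helm_distance_matrix m *\<^sub>v helm_kernel_vec = 0\<^sub>v (2 * m + 1)"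
proof -
  let ?z = helm_kernel_vec
  have z: "?z $ 0 = 0" "\<And>i. i \<in> {1..m} \<Longrightarrow> ?z $ i = (if even m then (- 1) ^ i else 0)"
    "\<And>i. i \<in> {1..m} \<Longrightarrow> ?z $ (m + i) = 0"
    by (auto simp: helm_kernel_vec_def)
  have alt: "?z $ cyc_succ m i = - ?z $ i" if "i \<in> {1..m}" for i
    using that cyc_succ_mem[OF that] by (auto simp: z cyc_succ_def)
  \<comment> \<open>The shift preserves the sum but flips every sign, so the sum vanishes.\<close>
  have "(\<Sum>i = 1..m. ?z $ i) = (\<Sum>i = 1..m. ?z $ cyc_succ m i)"
    by (rule sum_cyc_succ[symmetric])
  also have "\<dots> = - (\<Sum>i = 1..m. ?z $ i)" by (simp add: alt sum_negf)
  finally have Rim: "(\<Sum>i = 1..m. ?z $ i) = 0" by simp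
  have G: "(\<Sum>j = 1..m. cyc_gram m i j * ?z $ j) = 0" if "i \<in> {1..m}" for i
    using cyc_gram_alternating[of m "\<lambda>i. ?z $ i", OF alt that] .
  have "\<forall>i<2 * m + 1. (helm_distance_matrix m *\<^sub>v ?z) $ i = 0"
    unfolding all_helm_index
    using Rim G by (simp add: helm_mult_vec[OF helm_kernel_vec_carrier] z(1,3))
  then show ?thesis using helm_distance_matrix_carrier by (intro eq_vecI) auto
qed

lemma helm_kernel_multiple:
  assumes x: "x \<in> carrier_vec (2 * m + 1)" "helm_distance_matrix m *\<^sub>v x = 0\<^sub>v (2 * m + 1)"
  shows "\<exists>c. x = c \<cdot>\<^sub>v helm_kernel_vec"
proof -
  note ker = helm_kernel[OF x]
  \<comment> \<open>The kernel vector starts with the value -1 at rim index 1, hence the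
    sign.\<close>
  define c where "c = - x $ 1"
  have alt: "x $ Suc i = (- 1) ^ Suc i * c" if "i < m" for i
    using that
  proof (induction i)
    case 0
    show ?case by (simp add: c_def)
  next
    case (Suc i)
    then show ?case using ker(3)[of "Suc i"] by (simp add: cyc_succ_def)
  qed
  have rim: "x $ i = (- 1) ^ i * c" if "i \<in> {1..m}" for i
  proof -
    have "Suc (i - 1) = i" "i - 1 < m" using that by auto
    then show ?thesis using alt[of "i - 1"] by (simp only:)
  qed
  \<comment> \<open>The edge closing the rim: for odd \<open>m\<close> the alternation gives x_m =
    -c, so x_1 = c, while x_1 = -c by definition.\<close>
  have "x $ 1 = - x $ m" using ker(3)[of m] m by (simp add: cyc_succ_def)
  then have odd: "c = 0" if "odd m" using rim[of m] m that by (simp add: c_def)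
  have "\<forall>i<2 * m + 1. x $ i = (c \<cdot>\<^sub>v helm_kernel_vec) $ i"
    unfolding all_helm_index using ker(1,2) rim odd by (auto simp: helm_kernel_vec_def)
  then have "x = c \<cdot>\<^sub>v helm_kernel_vec"
    using x by (intro eq_vecI) (auto simp: helm_kernel_vec_def)
  then show ?thesis ..
qed

lemma inertia_helm_distance_matrix:
  "inertia (helm_distance_matrix m) = (if odd m then (1, 2 * m, 0) else (1, 2 * m - 1, 1))"
proof -
  let ?D = "helm_distance_matrix m"
  obtain x where x: "x \<in> carrier_vec (2 * m + 1)" "x \<bullet> (?D *\<^sub>v x) > 0"
    using helm_positive_vector by blast
  \<comment> \<open>The hyperplane is the orthogonal complement of the hub row, which reads P + 2Q =
    0; there the form is minus a sum of squares.\<close>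
  have w: "row ?D 0 \<in> carrier_vec (2 * m + 1)"
    using helm_distance_matrix_carrier by (metis carrier_matD(2) row_carrier)
  have "y \<bullet> (?D *\<^sub>v y) \<le> 0" if y: "y \<in> carrier_vec (2 * m + 1)" and "row ?D 0 \<bullet> y = 0" for y
  proof -
    have "(?D *\<^sub>v y) $ 0 = 0" using that helm_distance_matrix_carrier by simp
    then have 0: "(\<Sum>i = 1..m. y $ i) + 2 * (\<Sum>i = 1..m. y $ (m + i)) = 0"
      by (simp add: helm_mult_vec[OF y])
    have "(\<Sum>i = 1..m. (f i)\<^sup>2) \<ge> (0 :: real)" for f by (simp add: sum_nonneg)
    from this[of "\<lambda>i. y $ i + y $ (m + i) + (y $ cyc_succ m i + y $ (m + cyc_succ m i))"]
      this[of "\<lambda>i. y $ (m + i)"]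
    show ?thesis unfolding helm_form[OF y] 0 by simp
  qed
  from inertia_one_positive[OF helm_distance_matrix_carrier helm_distance_matrix_symmetric w this x
      helm_kernel_vec_carrier helm_mult_kernel_vec helm_kernel_multiple]
  show ?thesis unfolding helm_kernel_vec_eq_0_iff by auto
qed

end

theorem theorem3p3:
  fixes n :: nat
  assumes "n \<ge> 4"
  shows "inertia (distance_matrix (helm_graph n) (helm_vertices n)) =
    (if even n then (1, 2 * n - 2, 0) else (1, 2 * n - 3, 1))"
proof -
  obtain m where "n = m + 1" "m \<ge> 3"
    using assms that[of "n - 1"] by simp
  then show ?thesis using inertia_helm_distance_matrix[of m] by (auto simp: helm_distance_matrix_def)
qed

end
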